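(* Let $X$ be a real vector space, and let $C \subseteq X$ and $F \subseteq C$ be convex sets. Then $F$ is a face of $C$ precisely when any, hence all, of the following equivalent statements hold. 1. For all $x, y \in C$, if $]x,y[ \, \cap F \neq \varnothing$ then $x, y \in F$. 2. For $K := \operatorname{cone}(C \times \{1\}) \subseteq X \times \mathbb{R}$, there is a face $T$ of the convex cone $K$ such that $F = \gamma_1^{-1}(T)$. 3. Either $F = \varnothing$, or $F = \min_P C$ for some compatible preorder $P \subseteq X$. 4. $F = C \cap \ker f$ for some oriented affine map $f: X \to (Y, Y_+)$ that is positive on $C$. 5. $F = C \cap L$ for some supporting flat $L$ of $C$.
   Context: Vector spaces are real, of arbitrary (possibly infinite) dimension, with no topology. A convex cone contains the origin and is closed under addition and under multiplication by positive scalars; it is pointed if $K \cap (-K) = \{0\}$. $\operatorname{cone}(S) := \{\lambda s \mid \lambda \ge 0, s \in S\}$, with the convention $\operatorname{cone}(\varnothing) = \{0\}$. $\gamma_1: X \to X \times \mathbb{R}$ is $\gamma_1(x) := (x,1)$. $]x,y[$ is the line segment from $x$ to $y$ with endpoints excluded. A compatible preorder on $X$ is identified with its positive cone, a convex cone $P \subseteq X$, via $x \le_P y \iff y-x \in P$; $\min_P S := \{s \in S \mid s \le_P s' \text{ for all } s' \in S\}$. An oriented linear (resp. affine) map $f: W \to (Y,Y_+)$ is a linear (resp. affine) map from a real vector space $W$ to a real vector space $Y$ equipped with a pointed convex cone $Y_+ \subseteq Y$; it is positive on $S$ if $f(S) \subseteq Y_+$; $\ker f := f^{-1}(0)$, which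 may be empty for affine $f$. A face of a convex cone $K \subseteq W$ is a set $K \cap \ker \psi$ for an oriented linear map $\psi$ on $W$ positive on $K$. The definition of a face of a convex set $C \subseteq X$ is condition 4. A supporting flat of a convex set $C \subseteq X$ is a set of the form $\ker f$ for an oriented affine map $f$ on $X$ that is positive on $C$. *)

theory Defs
  imports "HOL-Analysis.Analysis"
begin

definition pointed :: "'a::real_vector set \<Rightarrow> bool" where
  "pointed K \<longleftrightarrow> K \<inter> uminus ` K = {0}"

(* Differs from "cone hull S" only in that cone_of {} = {0}. *)
definition cone_of :: "'a::real_vector set \<Rightarrow> 'a set" where
  "cone_of S = (if S = {} then {0} else {c *\<^sub>R s | c s. 0 \<le> c \<and> s \<in> S})"

definition gamma1 :: "'a \<Rightarrow> 'a \<times> real" where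
  "gamma1 x = (x, 1)"

(* A compatible preorder is represented by its positive cone P, with convex_cone P. *)
definition cone_le :: "'a::real_vector set \<Rightarrow> 'a \<Rightarrow> 'a \<Rightarrow> bool" where
  "cone_le P x y \<longleftrightarrow> y - x \<in> P"

definition cone_min :: "'a::real_vector set \<Rightarrow> 'a set \<Rightarrow> 'a set" where
  "cone_min P S = {s \<in> S. \<forall>s' \<in> S. cone_le P s s'}"

definition affine_map :: "('a::real_vector \<Rightarrow> 'b::real_vector) \<Rightarrow> bool" where
  "affine_map f \<longleftrightarrow>
     (\<forall>x y u v. u + v = 1 \<longrightarrow> f (u *\<^sub>R x + v *\<^sub>R y) = u *\<^sub>R f x + v *\<^sub>R f y)"

(* An oriented map is a pair of a map f and a pointed convex cone in its codomain. *)
definition oriented_linear ::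
    "('a::real_vector \<Rightarrow> 'b::real_vector) \<Rightarrow> 'b set \<Rightarrow> bool" where
  "oriented_linear f Yp \<longleftrightarrow> linear f \<and> convex_cone Yp \<and> pointed Yp"

definition oriented_affine ::
    "('a::real_vector \<Rightarrow> 'b::real_vector) \<Rightarrow> 'b set \<Rightarrow> bool" where
  "oriented_affine f Yp \<longleftrightarrow> affine_map f \<and> convex_cone Yp \<and> pointed Yp"

definition positive_map_on :: "'a set \<Rightarrow> ('a \<Rightarrow> 'b) \<Rightarrow> 'b set \<Rightarrow> bool" where
  "positive_map_on S f Yp \<longleftrightarrow> f ` S \<subseteq> Yp"

definition ker :: "('a \<Rightarrow> 'b::zero) \<Rightarrow> 'a set" where
  "ker f = f -` {0}"

(* The next three notions involve an existential quantifier over the codomain of an oriented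
   map. Since HOL does not quantify over types, the codomain is an explicit type argument. *)

definition cone_face ::
    "'y::real_vector itself \<Rightarrow> 'w::real_vector set \<Rightarrow> 'w set \<Rightarrow> bool" where
  "cone_face _ T K \<longleftrightarrow>
     (\<exists>(\<psi> :: 'w \<Rightarrow> 'y) Yp. oriented_linear \<psi> Yp \<and> positive_map_on K \<psi> Yp \<and> T = K \<inter> ker \<psi>)"

definition convex_face ::
    "'y::real_vector itself \<Rightarrow> 'a::real_vector set \<Rightarrow> 'a set \<Rightarrow> bool" where
  "convex_face _ F C \<longleftrightarrow>
     (\<exists>(f :: 'a \<Rightarrow> 'y) Yp. oriented_affine f Yp \<and> positive_map_on C f Yp \<and> F = C \<inter> ker f)"

definition supporting_flat ::
    "'y::real_vector itself \<Rightarrow> 'a::real_vector set \<Rightarrow> 'a set \<Rightarrow> bool" where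
  "supporting_flat _ L C \<longleftrightarrow>
     (\<exists>(f :: 'a \<Rightarrow> 'y) Yp. oriented_affine f Yp \<and> positive_map_on C f Yp \<and> L = ker f)"

end

(* Condition 1 says F face_of C in the sense of the library. The substance is that such
   an F comes from an oriented map. The cone T over F is then a face_of the cone K over C, and a
   linear map psi whose kernel is the subspace T - T does the job: psi(K) is pointed because
   k + k' + t in T with k, k' in K and t in T forces k and k' into T. Since a linear complement
   of T - T exists, the quotient by T - T can be realised inside the ambient space as
   x |-> x - g x for a projection g onto T - T, so the codomain may be 'a \<times> real.
   For the description by preorders take P to be the cone generated by C - F. *)

theory Submission
  imports Defs
begin

section \<open>Faces of a convex cone as kernels of oriented linear maps\<close>

lemma face_of_convex_combinationD:
  assumes "F face_of C" "x \<in> C" "y \<in> C" "u > 0" "v > 0" "u + v = 1" "u *\<^sub>R x + v *\<^sub>R y \<in> F"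
  shows "x \<in> F \<and> y \<in> F"
\<comment> \<open>\<open>open_segment x x\<close> is empty, so the definition of a face says nothing
  when the end points agree.\<close>
proof (cases "x = y")
  case True
  with assms show ?thesis by (simp flip: scaleR_add_left)
next
  case False
  have "u *\<^sub>R x + v *\<^sub>R y \<in> open_segment x y"
    using False assms by (auto simp: in_segment intro!: exI[of _ v])
  then show ?thesis
    using assms(1-3,7) unfolding face_of_def by blast
qed

text \<open>A face of a convex cone is conic, so along with \<open>x + y\<close> it contains the
  midpoint of \<open>x\<close> and \<open>y\<close>, to which the face property applies.\<close>

lemma face_of_convex_cone_addD:
  assumes "convex_cone K" "T face_of K" "x \<in> K" "y \<in> K" "x + y \<in> T"
  shows "x \<in> T"
proof -
  have "conic T"
    using assms(1,2) face_of_conic by (auto simp: convex_cone_def)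
  then have "(1/2) *\<^sub>R (x + y) \<in> T"
    using assms(5) by (simp add: conic_def)
  then show ?thesis
    using face_of_convex_combinationD[OF assms(2-4), of "1/2" "1/2"] by (simp add: scaleR_add_right)
qed

lemma subspace_convex_cone_differences:
  assumes "convex_cone T"
  shows "subspace {x - y | x y. x \<in> T \<and> y \<in> T}"
  unfolding subspace_convex_cone_symmetric
proof
  \<comment> \<open>This is T + (-T), in the shape required by the closure rule for sums; a convex
    cone closed under negation is a subspace.\<close>
  have *: "{x - y | x y. x \<in> T \<and> y \<in> T} = (\<Union>x\<in>T. \<Union>y\<in>uminus ` T. {x + y})"
    by force
  show "convex_cone {x - y | x y. x \<in> T \<and> y \<in> T}"
    unfolding * by (intro convex_cone_sums convex_cone_negations assms)
  show "\<forall>z\<in>{x - y | x y. x \<in> T \<and> y \<in> T}. - z \<in> {x - y | x y. x \<in> T \<and> y \<in> T}"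
    by force
qed

lemma subspace_is_kernel:
  fixes V :: "'a::real_vector set"
  assumes "subspace V"
  obtains \<psi> :: "'a \<Rightarrow> 'a" where "linear \<psi>" "ker \<psi> = V"
proof -
  \<comment> \<open>A linear left inverse of the identity on \<open>V\<close> with range in
    \<open>V\<close> is a projection onto \<open>V\<close>, in any dimension.\<close>
  obtain g :: "'a \<Rightarrow> 'a" where g: "range g \<subseteq> V" "linear g" "\<forall>v\<in>V. g v = v"
    using linear_exists_left_inverse_on[OF linear_ident assms] by auto
  have "linear (\<lambda>x. x - g x)"
    using g(2) by (intro linear_compose_sub linear_ident)
  moreover have "ker (\<lambda>x. x - g x) = V"
    using g by (force simp: ker_def)
  ultimately show ?thesis
    using that by blast
qed

text \<open>The codomain is ordered by the image of \<open>K\<close> itself. Positivity is then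
  automatic, and what remains is that this image is pointed and that the kernel cuts out exactly
  \<open>T\<close>.\<close>

lemma face_of_imp_cone_face:
  fixes K T :: "'w::real_vector set"
  assumes K: "convex_cone K" and T: "T face_of K" "T \<noteq> {}"
  shows "cone_face TYPE('w) T K"
proof -
  have cT: "convex_cone T"
    using K T(2) face_of_conic[OF _ T(1)] face_of_imp_convex[OF T(1)] by (simp add: convex_cone_def)
  obtain \<psi> :: "'w \<Rightarrow> 'w" where \<psi>: "linear \<psi>" "ker \<psi> = {x - y | x y. x \<in> T \<and> y \<in> T}"
    using subspace_is_kernel[OF subspace_convex_cone_differences[OF cT]] .
  \<comment> \<open>This serves twice: for general \<open>k'\<close> it yields pointedness of the
    image, and for \<open>k' = 0\<close> the inclusion of \<open>K \<inter> ker \<psi>\<close> in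
    \<open>T\<close>.\<close>
  have kerT: "k \<in> T" if k: "k \<in> K" "k' \<in> K" "\<psi> (k + k') = 0" for k k'
  proof -
    obtain s t where st: "s \<in> T" "t \<in> T" "k + k' = s - t"
    proof -
      have "k + k' \<in> ker \<psi>"
        using k(3) by (simp add: ker_def)
      then show ?thesis
        using that unfolding \<psi>(2) by blast
    qed
    have "k' + t \<in> K"
      using K T(1) st(2) k(2) convex_cone_add face_of_imp_subset by blast
    moreover have "k + (k' + t) \<in> T"
      using st by (simp flip: add.assoc)
    ultimately show ?thesis
      using face_of_convex_cone_addD[OF K T(1) k(1)] by blast
  qed
  have ker_eq: "\<psi> t = 0" if "t \<in> T" for t
  proof -
    have "t - 0 \<in> ker \<psi>"
      using that cT convex_cone_contains_0 \<psi>(2) by blast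
    then show ?thesis by (simp add: ker_def)
  qed
  have "pointed (\<psi> ` K)"
  proof -
    have "\<psi> k = 0" if "k \<in> K" "k' \<in> K" "\<psi> k = - \<psi> k'" for k k'
    proof -
      have "\<psi> (k + k') = 0"
        using that(3) by (simp add: linear_add[OF \<psi>(1)])
      then show ?thesis
        using kerT that(1,2) ker_eq by blast
    qed
    moreover have "0 \<in> \<psi> ` K"
      using K \<psi>(1) convex_cone_contains_0 linear_0 by (metis image_eqI)
    ultimately show ?thesis
      unfolding pointed_def by force
  qed
  moreover have "convex_cone (\<psi> ` K)"
    using K \<psi>(1) convex_cone_linear_image by blast
  moreover have "T = K \<inter> ker \<psi>"
    using face_of_imp_subset[OF T(1)] ker_eq kerT[where k' = 0] convex_cone_contains_0[OF K]
    by (auto simp: ker_def)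
  ultimately show ?thesis
    using \<psi>(1) unfolding cone_face_def oriented_linear_def positive_map_on_def by blast
qed

section \<open>The cone over a convex set placed at height one\<close>

lemma cone_of_eq_convex_cone_hull:
  "convex S \<Longrightarrow> cone_of S = convex_cone hull S"
  by (simp add: cone_of_def convex_cone_hull_separate_nonempty conic_hull_explicit convex_hull_eq[THEN iffD2]
      hull_same)

lemma convex_cone_cone_of: "convex S \<Longrightarrow> convex_cone (cone_of S)"
  by (simp add: cone_of_eq_convex_cone_hull convex_cone_convex_cone_hull)

text \<open>The slice at height t > 0 is t times \<open>S\<close>, and at height 0 only the apex
  remains. The convention for the empty set keeps this true when \<open>S\<close> is empty.\<close>

lemma in_cone_of_Times_one_iff:
  "(x, t) \<in> cone_of (S \<times> {1::real}) \<longleftrightarrow> x = 0 \<and> t = 0 \<or> t > 0 \<and> x /\<^sub>R t \<in> S"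
proof
  assume "(x, t) \<in> cone_of (S \<times> {1})"
  then show "x = 0 \<and> t = 0 \<or> t > 0 \<and> x /\<^sub>R t \<in> S"
    by (cases "t = 0") (auto simp: cone_of_def zero_prod_def split: if_splits)
next
  assume "x = 0 \<and> t = 0 \<or> t > 0 \<and> x /\<^sub>R t \<in> S"
  then show "(x, t) \<in> cone_of (S \<times> {1})"
  proof
    assume "x = 0 \<and> t = 0"
    then show ?thesis
      by (auto simp: cone_of_def zero_prod_def)
  next
    assume t: "t > 0 \<and> x /\<^sub>R t \<in> S"
    then have "(x, t) = t *\<^sub>R (x /\<^sub>R t, 1)" by simp
    with t show ?thesis
      unfolding cone_of_def by (smt (verit, best) SigmaI empty_iff mem_Collect_eq singletonI)
  qed
qed

lemma gamma1_vimage_cone_of: "gamma1 -` cone_of (S \<times> {1::real}) = S"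
  by (auto simp: gamma1_def in_cone_of_Times_one_iff)

text \<open>Rescaling to height one turns a positive combination of points of the cone into a convex
  combination of points of \<open>C\<close>, where the face property of \<open>F\<close> applies.
  The apex has no such rescaling and is treated apart.\<close>

lemma face_of_cone_of_Times_one:
  assumes F: "F face_of C"
  shows "cone_of (F \<times> {1::real}) face_of cone_of (C \<times> {1})"
  unfolding face_of_def
proof (intro conjI ballI impI)
  show "cone_of (F \<times> {1::real}) \<subseteq> cone_of (C \<times> {1})"
    using face_of_imp_subset[OF F] by (auto simp: in_cone_of_Times_one_iff)
  show "convex (cone_of (F \<times> {1::real}))"
    using convex_cone_cone_of[of "F \<times> {1::real}"] face_of_imp_convex[OF F]
    by (simp add: convex_cone_def convex_Times)
next
  \<comment> \<open>The weights need not sum to 1, and only the first point is treated; swapping the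
    points gives the other one.\<close>
  have *: "a \<in> cone_of (F \<times> {1})"
    if ab: "a \<in> cone_of (C \<times> {1})" "b \<in> cone_of (C \<times> {1})"
      and uv: "u > 0" "v > 0"
      and w: "u *\<^sub>R a + v *\<^sub>R b \<in> cone_of (F \<times> {1::real})" for a b u v
  proof -
    obtain x s y t where a: "a = (x, s)" and b: "b = (y, t)"
      by (metis surj_pair)
    consider "s = 0" "x = 0" | "s > 0" "x /\<^sub>R s \<in> C" "t = 0" "y = 0"
      | "s > 0" "x /\<^sub>R s \<in> C" "t > 0" "y /\<^sub>R t \<in> C"
      using ab unfolding a b in_cone_of_Times_one_iff by blast
    then show ?thesis
    proof cases
      case 1
      then show ?thesis by (simp add: a in_cone_of_Times_one_iff)
    next
      case 2
      then have "(u *\<^sub>R x) /\<^sub>R (u * s) \<in> F"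
        using w uv by (simp add: a b in_cone_of_Times_one_iff)
      moreover have "(u *\<^sub>R x) /\<^sub>R (u * s) = x /\<^sub>R s"
        using uv by simp
      ultimately show ?thesis
        using 2 unfolding a in_cone_of_Times_one_iff by metis
    next
      \<comment> \<open>Here \<open>r\<close> is the height of
        \<open>u *\<^sub>R a + v *\<^sub>R b\<close>. After division by \<open>r\<close>, each
        rescaled point is weighted by its share of that height.\<close>
      case 3
      define r where "r = u * s + v * t"
      have r: "r > 0" using 3 uv by (simp add: r_def add_pos_pos)
      have "(u *\<^sub>R x + v *\<^sub>R y) /\<^sub>R r \<in> F"
        using w r by (simp add: a b in_cone_of_Times_one_iff r_def)
      moreover have "(u *\<^sub>R x + v *\<^sub>R y) /\<^sub>R r = (u * s / r) *\<^sub>R (x /\<^sub>R s) + (v * t / r) *\<^sub>R (y /\<^sub>R t)"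
        using 3 by (simp add: scaleR_add_right field_simps)
      moreover have "u * s / r + v * t / r = 1"
        using r by (simp add: r_def flip: add_divide_distrib)
      ultimately have "x /\<^sub>R s \<in> F"
        using face_of_convex_combinationD[OF F 3(2,4), of "u * s / r" "v * t / r"] 3 uv r by simp
      then show ?thesis
        using 3 by (simp add: a in_cone_of_Times_one_iff)
    qed
  qed
  fix a b w
  assume ab: "a \<in> cone_of (C \<times> {1::real})" "b \<in> cone_of (C \<times> {1})"
    and w: "w \<in> cone_of (F \<times> {1})" "w \<in> open_segment a b"
  obtain u where u: "0 < u" "u < 1" "w = (1 - u) *\<^sub>R a + u *\<^sub>R b"
    using w(2) by (auto simp: in_segment)
  show "a \<in> cone_of (F \<times> {1})"
    using *[OF ab, of "1 - u" u] u w(1) by simp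
  show "b \<in> cone_of (F \<times> {1})"
    using *[OF ab(2,1), of u "1 - u"] u w(1) by (simp add: add.commute)
qed

lemma face_of_imp_gamma1_vimage_cone_face:
  fixes C F :: "'a::real_vector set"
  assumes "convex C" "F face_of C"
  shows "\<exists>T. cone_face TYPE('a \<times> real) T (cone_of (C \<times> {1::real})) \<and> F = gamma1 -` T"
proof (intro exI conjI)
  have "0 \<in> cone_of (F \<times> {1::real})"
    by (simp add: zero_prod_def in_cone_of_Times_one_iff)
  then show "cone_face TYPE('a \<times> real) (cone_of (F \<times> {1})) (cone_of (C \<times> {1::real}))"
    using assms
    by (intro face_of_imp_cone_face convex_cone_cone_of face_of_cone_of_Times_one convex_Times) auto
qed (simp add: gamma1_vimage_cone_of)

section \<open>From linear maps on the cone to affine maps and back to faces\<close>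

lemma affine_map_linear_gamma1:
  assumes "linear \<psi>"
  shows "affine_map (\<psi> \<circ> gamma1)"
  unfolding affine_map_def
proof (intro allI impI)
  fix x y :: 'a and u v :: real
  assume uv: "u + v = 1"
  then have "gamma1 (u *\<^sub>R x + v *\<^sub>R y) = u *\<^sub>R gamma1 x + v *\<^sub>R gamma1 y"
    by (simp add: gamma1_def)
  then show "(\<psi> \<circ> gamma1) (u *\<^sub>R x + v *\<^sub>R y) = u *\<^sub>R (\<psi> \<circ> gamma1) x + v *\<^sub>R (\<psi> \<circ> gamma1) y"
    using assms by (simp add: linear_add linear_scale)
qed

text \<open>Composition with \<open>gamma1\<close> restricts \<psi> to height one, where the cone is
  a copy of \<open>C\<close>; the codomain and its positive cone stay the same.\<close>

lemma gamma1_vimage_cone_face_imp_convex_face: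
  assumes "cone_face TYPE('y::real_vector) T (cone_of (C \<times> {1::real}))"
  shows "convex_face TYPE('y) (gamma1 -` T) C"
proof -
  obtain \<psi> :: "'a \<times> real \<Rightarrow> 'y" and Yp where
    \<psi>: "oriented_linear \<psi> Yp" "positive_map_on (cone_of (C \<times> {1::real})) \<psi> Yp"
      "T = cone_of (C \<times> {1}) \<inter> ker \<psi>"
    using assms unfolding cone_face_def by blast
  have gamma1: "gamma1 x \<in> cone_of (C \<times> {1::real}) \<longleftrightarrow> x \<in> C" for x
    using gamma1_vimage_cone_of[of C] by blast
  have "oriented_affine (\<psi> \<circ> gamma1) Yp"
    using \<psi>(1) affine_map_linear_gamma1
    unfolding oriented_linear_def oriented_affine_def by blast
  moreover have "positive_map_on C (\<psi> \<circ> gamma1) Yp"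
    using \<psi>(2) gamma1 by (auto simp: positive_map_on_def)
  moreover have "gamma1 -` T = C \<inter> ker (\<psi> \<circ> gamma1)"
    by (simp add: set_eq_iff \<psi>(3) ker_def gamma1)
  ultimately show ?thesis
    unfolding convex_face_def by blast
qed

lemma convex_face_imp_face_of:
  assumes "convex F" "convex_face TYPE('y::real_vector) F C"
  shows "F face_of C"
  unfolding face_of_def
proof (intro conjI ballI impI)
  obtain f :: "'a \<Rightarrow> 'y" and Yp where
    f: "affine_map f" "convex_cone Yp" "pointed Yp" "f ` C \<subseteq> Yp" and F: "F = C \<inter> ker f"
    using assms(2) unfolding convex_face_def oriented_affine_def positive_map_on_def by blast
  show "F \<subseteq> C" by (simp add: F)
  show "convex F" by fact
  have *: "x \<in> F" if xy: "x \<in> C" "y \<in> C" and uv: "u > 0" "v > 0" "u + v = 1"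
    and z: "u *\<^sub>R x + v *\<^sub>R y \<in> F" for x y u v
  proof -
    have "u *\<^sub>R f x + v *\<^sub>R f y = 0"
      using z f(1) uv(3) by (simp add: F ker_def affine_map_def)
    then have "u *\<^sub>R f x = - (v *\<^sub>R f y)"
      by (rule eq_neg_iff_add_eq_0[THEN iffD2])
    moreover have "u *\<^sub>R f x \<in> Yp" "v *\<^sub>R f y \<in> Yp"
      using f(2,4) xy uv by (auto intro!: convex_cone_scaleR)
    ultimately have "u *\<^sub>R f x \<in> Yp \<inter> uminus ` Yp" by auto
    then have "f x = 0"
      using f(3) uv(1) unfolding pointed_def by auto
    then show ?thesis using xy(1) by (simp add: F ker_def)
  qed
  fix x y z
  assume xy: "x \<in> C" "y \<in> C" and z: "z \<in> F" "z \<in> open_segment x y"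
  obtain u where u: "0 < u" "u < 1" "z = (1 - u) *\<^sub>R x + u *\<^sub>R y"
    using z(2) by (auto simp: in_segment)
  show "x \<in> F"
    using *[OF xy, of "1 - u" u] u z(1) by simp
  show "y \<in> F"
    using *[OF xy(2,1), of u "1 - u"] u z(1) by (simp add: add.commute)
qed

section \<open>Faces as sets of minimal elements\<close>

lemma convex_cone_min_face_of:
  assumes "convex C" and P: "convex_cone P"
  shows "cone_min P C face_of C"
  unfolding face_of_def
proof (intro conjI ballI impI)
  show "cone_min P C \<subseteq> C" by (auto simp: cone_min_def)
  show "convex (cone_min P C)"
  proof (rule convexI)
    fix x y and u v :: real
    assume xy: "x \<in> cone_min P C" "y \<in> cone_min P C" and uv: "0 \<le> u" "0 \<le> v" "u + v = 1"
    have "s - (u *\<^sub>R x + v *\<^sub>R y) \<in> P" if "s \<in> C" for s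
    proof -
      have "s - (u *\<^sub>R x + v *\<^sub>R y) = u *\<^sub>R (s - x) + v *\<^sub>R (s - y)"
        using uv(3) by (simp add: algebra_simps flip: scaleR_add_left)
      then show ?thesis
        using xy that uv P
        by (auto simp: cone_min_def cone_le_def intro!: convex_cone_add convex_cone_scaleR)
    qed
    then show "u *\<^sub>R x + v *\<^sub>R y \<in> cone_min P C"
      using xy uv \<open>convex C\<close> by (auto simp: cone_min_def cone_le_def convex_def)
  qed
next
  have *: "x \<in> cone_min P C" if xy: "x \<in> C" "y \<in> C" and u: "0 < u" "u < 1"
    and z: "(1 - u) *\<^sub>R x + u *\<^sub>R y \<in> cone_min P C" for x y u
  proof -
    let ?z = "(1 - u) *\<^sub>R x + u *\<^sub>R y"
    have min: "s - ?z \<in> P" if "s \<in> C" for s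
      using z that by (auto simp: cone_min_def cone_le_def)
    have "y - ?z = (1 - u) *\<^sub>R (y - x)" "?z - x = u *\<^sub>R (y - x)"
      by (simp_all add: algebra_simps)
    \<comment> \<open>Both differences are positive multiples of \<open>y - x\<close>. As
      \<open>?z\<close> lies below \<open>y\<close>, it follows that \<open>x\<close> lies below
      \<open>?z\<close> and hence below all of \<open>C\<close>.\<close>
    then have "?z - x = (u / (1 - u)) *\<^sub>R (y - ?z)"
      using u by simp
    then have "?z - x \<in> P"
      using min[OF xy(2)] u P by (simp add: convex_cone_scaleR)
    then have "s - x \<in> P" if "s \<in> C" for s
      using convex_cone_add[OF P min[OF that]] by fastforce
    then show ?thesis
      using xy(1) by (simp add: cone_min_def cone_le_def)
  qed
  fix x y z
  assume xy: "x \<in> C" "y \<in> C" and z: "z \<in> cone_min P C" "z \<in> open_segment x y"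
  obtain u where u: "0 < u" "u < 1" "z = (1 - u) *\<^sub>R x + u *\<^sub>R y"
    using z(2) by (auto simp: in_segment)
  show "x \<in> cone_min P C"
    using *[OF xy u(1,2)] u(3) z(1) by simp
  show "y \<in> cone_min P C"
    using *[OF xy(2,1), of "1 - u"] u z(1) by (simp add: add.commute)
qed

text \<open>If \<open>s\<close> is minimal and \<open>e\<close> is in \<open>F\<close>, then e - s =
  k (c - e') with \<open>c\<close> in \<open>C\<close> and \<open>e'\<close> in \<open>F\<close>.
  Moving terms gives s + k c = e + k e', which after normalisation puts a convex combination of
  \<open>s\<close> and \<open>c\<close> into \<open>F\<close>.\<close>

lemma face_of_imp_cone_min:
  assumes "convex C" and F: "F face_of C" "F \<noteq> {}"
  shows "\<exists>P. convex_cone P \<and> F = cone_min P C"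
proof (intro exI conjI)
  let ?D = "\<Union>c\<in>C. \<Union>e\<in>F. {c - e}"
  note FC = face_of_imp_subset[OF F(1)]
  show "convex_cone (cone_of ?D)"
    using assms(1) face_of_imp_convex[OF F(1)] by (intro convex_cone_cone_of convex_differences)
  have "?D \<noteq> {}" using F(2) FC by auto
  then have D: "cone_of ?D = {c *\<^sub>R s | c s. 0 \<le> c \<and> s \<in> ?D}"
    by (simp add: cone_of_def)
  show "F = cone_min (cone_of ?D) C"
  proof (intro equalityI subsetI)
    fix e assume e: "e \<in> F"
    have "c - e \<in> cone_of ?D" if "c \<in> C" for c
      unfolding D using that e by (intro CollectI exI[of _ 1] exI[of _ "c - e"]) auto
    then show "e \<in> cone_min (cone_of ?D) C"
      using e FC by (auto simp: cone_min_def cone_le_def)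
  next
    fix s assume s: "s \<in> cone_min (cone_of ?D) C"
    obtain e where e: "e \<in> F" using F(2) by blast
    then have "e - s \<in> cone_of ?D"
      using s FC by (auto simp: cone_min_def cone_le_def)
    then obtain k c e' where k: "0 \<le> k" "c \<in> C" "e' \<in> F" "e - s = k *\<^sub>R (c - e')"
      unfolding D by auto
    have sC: "s \<in> C" using s by (simp add: cone_min_def)
    show "s \<in> F"
    proof (cases "k = 0")
      case True
      with k e show ?thesis by simp
    next
      case False
      \<comment> \<open>The total weight on either side of s + k c = e + k e' is 1 + k.\<close>
      define u where "u = 1 / (1 + k)"
      have u: "0 < u" "0 < u * k" "u + u * k = 1"
        using k(1) False by (simp_all add: u_def field_simps)
      have "s + k *\<^sub>R c = e + k *\<^sub>R e'"
        using k(4) by (simp add: algebra_simps)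
      then have "u *\<^sub>R s + (u * k) *\<^sub>R c = u *\<^sub>R e + (u * k) *\<^sub>R e'"
        by (metis scaleR_add_right scaleR_scaleR)
      also have "\<dots> \<in> F"
        using face_of_imp_convex[OF F(1)] e k(3) u by (intro convexD) auto
      finally show ?thesis
        using face_of_convex_combinationD[OF F(1) sC k(2) u] by blast
    qed
  qed
qed

(* The first five conjuncts are the equivalences, with oriented maps valued in the sufficiently
   large space 'a \<times> real. The last three concern oriented maps valued in an arbitrary real
   vector space 'y, so that together they settle the existential quantifier over all codomains. *)
theorem theorem3p19:
  fixes C F :: "'a::real_vector set"
  assumes "convex C" and "convex F" and "F \<subseteq> C"
  shows
   "(convex_face TYPE('a \<times> real) F C \<longleftrightarrow>
       (\<forall>x\<in>C. \<forall>y\<in>C. open_segment x y \<inter> F \<noteq> {} \<longrightarrow> x \<in> F \<and> y \<in> F))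
  \<and> (convex_face TYPE('a \<times> real) F C \<longleftrightarrow>
       (\<exists>T. cone_face TYPE('a \<times> real) T (cone_of (C \<times> {1::real})) \<and> F = gamma1 -` T))
  \<and> (convex_face TYPE('a \<times> real) F C \<longleftrightarrow>
       F = {} \<or> (\<exists>P. convex_cone P \<and> F = cone_min P C))
  \<and> (convex_face TYPE('a \<times> real) F C \<longleftrightarrow>
       (\<exists>(f :: 'a \<Rightarrow> 'a \<times> real) Yp.
          oriented_affine f Yp \<and> positive_map_on C f Yp \<and> F = C \<inter> ker f))
  \<and> (convex_face TYPE('a \<times> real) F C \<longleftrightarrow>
       (\<exists>L. supporting_flat TYPE('a \<times> real) L C \<and> F = C \<inter> L))
  \<and> ((\<exists>T. cone_face TYPE('y::real_vector) T (cone_of (C \<times> {1::real})) \<and> F = gamma1 -` T)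
       \<longrightarrow> convex_face TYPE('a \<times> real) F C)
  \<and> ((\<exists>(f :: 'a \<Rightarrow> 'y) Yp.
          oriented_affine f Yp \<and> positive_map_on C f Yp \<and> F = C \<inter> ker f)
       \<longrightarrow> convex_face TYPE('a \<times> real) F C)
  \<and> ((\<exists>L. supporting_flat TYPE('y) L C \<and> F = C \<inter> L)
       \<longrightarrow> convex_face TYPE('a \<times> real) F C)"
proof -
  have face: "F face_of C \<longleftrightarrow> (\<forall>x\<in>C. \<forall>y\<in>C. open_segment x y \<inter> F \<noteq> {} \<longrightarrow> x \<in> F \<and> y \<in> F)"
    using assms unfolding face_of_def by blast
  \<comment> \<open>The codomain \<open>'z\<close> is free here, so the fact applies both to
    \<open>'a \<times> real\<close> and to \<open>'y\<close>. Since \<open>face_of\<close> mentions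
    no codomain, it is the link between the two.\<close>
  have cone_face: "F face_of C" if "\<exists>T. cone_face TYPE('z::real_vector) T (cone_of (C \<times> {1::real})) \<and> F = gamma1 -` T"
    using that gamma1_vimage_cone_face_imp_convex_face convex_face_imp_face_of[OF \<open>convex F\<close>] by blast
  have convex_face: "convex_face TYPE('a \<times> real) F C \<longleftrightarrow> F face_of C"
    using face_of_imp_gamma1_vimage_cone_face[OF \<open>convex C\<close>]
      gamma1_vimage_cone_face_imp_convex_face convex_face_imp_face_of[OF \<open>convex F\<close>] by blast
  have min: "F face_of C \<longleftrightarrow> F = {} \<or> (\<exists>P. convex_cone P \<and> F = cone_min P C)"
    using face_of_imp_cone_min convex_cone_min_face_of \<open>convex C\<close> empty_face_of by metis
  have flat: "(\<exists>L. supporting_flat TYPE('z::real_vector) L C \<and> F = C \<inter> L) \<longleftrightarrow> convex_face TYPE('z) F C"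
    unfolding supporting_flat_def convex_face_def by blast
  have map: "(\<exists>(f :: 'a \<Rightarrow> 'z::real_vector) Yp.
      oriented_affine f Yp \<and> positive_map_on C f Yp \<and> F = C \<inter> ker f) \<longleftrightarrow> convex_face TYPE('z) F C"
    unfolding convex_face_def ..
  have K: "F face_of C \<longleftrightarrow>
      (\<exists>T. cone_face TYPE('a \<times> real) T (cone_of (C \<times> {1::real})) \<and> F = gamma1 -` T)"
    using cone_face face_of_imp_gamma1_vimage_cone_face[OF \<open>convex C\<close>] by (intro iffI)
  show ?thesis
    unfolding flat map convex_face
    by (intro conjI impI face K min refl cone_face convex_face_imp_face_of[OF \<open>convex F\<close>])
qed

end
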